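(* For every integer $n\ge 0$: $\tilde e(n,1,1)=S_{-1}(\tilde e(n,0,1))$ and $\tilde e(n,-1,1)=S_{-1}(\tilde e(n,0,1))+S_{-2}(\tilde e(n,0,0))$.
   Context: Let $\mathrm{CH}_2$ be the commutative ring which is a free $\mathbb{Z}$-module with basis $\{h_i : i\ge 0\}$ and multiplication $h_ih_j=\sum_{k=0}^{\min(i,j)}h_{i+j-2k}$. Let $\tilde{\mathrm{CH}}_2$ be the free $\mathbb{Z}$-module with basis $\{\tilde h_i : i\in\mathbb{Z}\}$, with left $\mathrm{CH}_2$-action $h_i\tilde h_j=\sum_{k=0}^{i}\tilde h_{j-i+2k}$ ($i\ge0$), extended bilinearly. Let $L:\tilde{\mathrm{CH}}_2\to \mathrm{CH}_2$ be the $\mathbb{Z}$-linear map with $L(\tilde h_{-1})=0$, $L(\tilde h_i)=h_i$ for $i\ge 0$, $L(\tilde h_i)=-h_{-i-2}$ for $i\le -2$. The (associative, non-commutative) product on $\tilde{\mathrm{CH}}_2$ is $g_1g_2:=L(g_1)\,g_2$; powers $g^2=gg$. For $i\in\mathbb{Z}$, $S_i$ is the $\mathbb{Z}$-linear map with $S_i(\tilde h_j)=\tilde h_{j+i}$. For $g_1,g_2,g_3\in\tilde{\mathrm{CH}}_2$ put $W_0(g_1,g_2,g_3)=g_2\big(g_1g_3-S_{-1}(g_1)S_{-1}(g_3)\big)$ and $W_1(g_1,g_2,g_3)=S_{-1}(g_1)g_2g_3+g_1g_2S_{-1}(g_3)-S_{-1}(g_1)\tilde h_1g_2S_{-1}(g_3)$.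 Define $E_n:=\tilde e(n,0,0)$ by $E_0=\tilde h_2$ and $E_{n+1}=E_n\big(E_n^2-(S_{-1}E_n)^2\big)$. Define $\tilde e(n,i,1)$ for $i\in\{-1,0,1\}$ by $\tilde e(0,0,1)=0$, $\tilde e(0,1,1)=0$, $\tilde e(0,-1,1)=\tilde h_0$, and, writing $F_n=\tilde e(n,0,1)$: $\tilde e(n+1,0,1)=W_0(E_n,E_n,F_n+S_{-1}E_n)+W_0(E_n,F_n,E_n)+W_0(F_n,E_n,E_n)$; $\tilde e(n+1,1,1)=W_1(E_n,E_n,F_n+S_{-1}E_n)+W_1(E_n,F_n,E_n)+W_1(F_n,E_n,E_n)$; $\tilde e(n+1,-1,1)=W_1(E_n,E_n,F_n+S_{-1}E_n)+W_1(E_n,F_n,E_n)+\tilde e(n,-1,1)E_nE_n+F_nE_nS_{-1}(E_n)-\tilde e(n,-1,1)\tilde h_1E_nS_{-1}(E_n)+2S_{-1}(E_n)E_nS_{-1}(E_n)-S_{-1}(E_n)\tilde h_1S_{-1}(E_n)S_{-1}(E_n)+S_{-1}(E_n)\big(\tilde e(n,-1,1)-\tilde e(n,1,1)\big)S_{-1}(E_n)$. *)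

theory Defs
  imports "HOL-Library.Poly_Mapping"
begin

text \<open>
  The two free \<open>\<int>\<close>-modules are the finitely supported integer functions on the index set of
  the basis; \<^const>\<open>frag_extend\<close> is \<open>\<int>\<close>-linear extension from the basis. The convolution
  product \<open>*\<close> that the library puts on these types is not one of the products below and is
  never used.
\<close>

type_synonym ch = "nat \<Rightarrow>\<^sub>0 int"
type_synonym cht = "int \<Rightarrow>\<^sub>0 int"

abbreviation h :: "nat \<Rightarrow> ch" where "h i \<equiv> frag_of i"
abbreviation ht :: "int \<Rightarrow> cht" where "ht i \<equiv> frag_of i"

definition ch_mult :: "ch \<Rightarrow> ch \<Rightarrow> ch"  (infixl \<open>\<otimes>\<close> 70) where
  "a \<otimes> b = frag_extend (\<lambda>i. frag_extend (\<lambda>j. \<Sum>k=0..min i j. h (i + j - 2 * k)) b) a"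

definition ch_act :: "ch \<Rightarrow> cht \<Rightarrow> cht"  (infixr \<open>\<bullet>\<close> 72) where
  "a \<bullet> g = frag_extend (\<lambda>i. frag_extend (\<lambda>j. \<Sum>k=0..i. ht (j - int i + 2 * int k)) g) a"

definition L :: "cht \<Rightarrow> ch" where
  "L = frag_extend (\<lambda>i. if i \<ge> 0 then h (nat i) else if i = -1 then 0 else - h (nat (- i - 2)))"

definition cht_mult :: "cht \<Rightarrow> cht \<Rightarrow> cht"  (infixl \<open>\<odot>\<close> 70) where
  "g\<^sub>1 \<odot> g\<^sub>2 = L g\<^sub>1 \<bullet> g\<^sub>2"

definition S :: "int \<Rightarrow> cht \<Rightarrow> cht" where
  "S i = frag_extend (\<lambda>j. ht (j + i))"

definition W0 :: "cht \<Rightarrow> cht \<Rightarrow> cht \<Rightarrow> cht" where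
  "W0 g\<^sub>1 g\<^sub>2 g\<^sub>3 = g\<^sub>2 \<odot> (g\<^sub>1 \<odot> g\<^sub>3 - S (-1) g\<^sub>1 \<odot> S (-1) g\<^sub>3)"

definition W1 :: "cht \<Rightarrow> cht \<Rightarrow> cht \<Rightarrow> cht" where
  "W1 g\<^sub>1 g\<^sub>2 g\<^sub>3 = S (-1) g\<^sub>1 \<odot> g\<^sub>2 \<odot> g\<^sub>3 + g\<^sub>1 \<odot> g\<^sub>2 \<odot> S (-1) g\<^sub>3
     - S (-1) g\<^sub>1 \<odot> ht 1 \<odot> g\<^sub>2 \<odot> S (-1) g\<^sub>3"

text \<open>
  The families \<open>e(n,0,0)\<close>, \<open>e(n,0,1)\<close>, \<open>e(n,1,1)\<close> and \<open>e(n,-1,1)\<close> (all with a tilde) are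
  \<open>et_0_0 n\<close>, \<open>et_0_1 n\<close>, \<open>et_1_1 n\<close> and \<open>et_m1_1 n\<close>.
\<close>

primrec et_0_0 :: "nat \<Rightarrow> cht" where
  "et_0_0 0 = ht 2"
| "et_0_0 (Suc n) =
     et_0_0 n \<odot> (et_0_0 n \<odot> et_0_0 n - S (-1) (et_0_0 n) \<odot> S (-1) (et_0_0 n))"

primrec et_0_1 :: "nat \<Rightarrow> cht" where
  "et_0_1 0 = 0"
| "et_0_1 (Suc n) =
     W0 (et_0_0 n) (et_0_0 n) (et_0_1 n + S (-1) (et_0_0 n))
   + W0 (et_0_0 n) (et_0_1 n) (et_0_0 n)
   + W0 (et_0_1 n) (et_0_0 n) (et_0_0 n)"

primrec et_1_1 :: "nat \<Rightarrow> cht" where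
  "et_1_1 0 = 0"
| "et_1_1 (Suc n) =
     W1 (et_0_0 n) (et_0_0 n) (et_0_1 n + S (-1) (et_0_0 n))
   + W1 (et_0_0 n) (et_0_1 n) (et_0_0 n)
   + W1 (et_0_1 n) (et_0_0 n) (et_0_0 n)"

primrec et_m1_1 :: "nat \<Rightarrow> cht" where
  "et_m1_1 0 = ht 0"
| "et_m1_1 (Suc n) =
     W1 (et_0_0 n) (et_0_0 n) (et_0_1 n + S (-1) (et_0_0 n))
   + W1 (et_0_0 n) (et_0_1 n) (et_0_0 n)
   + et_m1_1 n \<odot> et_0_0 n \<odot> et_0_0 n
   + et_0_1 n \<odot> et_0_0 n \<odot> S (-1) (et_0_0 n)
   - et_m1_1 n \<odot> ht 1 \<odot> et_0_0 n \<odot> S (-1) (et_0_0 n)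
   + frag_cmul 2 (S (-1) (et_0_0 n) \<odot> et_0_0 n \<odot> S (-1) (et_0_0 n))
   - S (-1) (et_0_0 n) \<odot> ht 1 \<odot> S (-1) (et_0_0 n) \<odot> S (-1) (et_0_0 n)
   + S (-1) (et_0_0 n) \<odot> (et_m1_1 n - et_1_1 n) \<odot> S (-1) (et_0_0 n)"

text \<open>
  Well-definedness of the setting: \<open>\<otimes>\<close> is a commutative ring product with unit \<open>h 0\<close>,
  \<open>\<bullet>\<close> is an action of that ring, \<open>L\<close> is equivariant, and hence
  \<open>\<odot>\<close> is associative, so that the products above do not depend on the bracketing.
\<close>

lemma frag_linear_eqI:
  fixes f g :: "('a \<Rightarrow>\<^sub>0 int) \<Rightarrow> ('b \<Rightarrow>\<^sub>0 int)"
  assumes "\<And>x y. f (x - y) = f x - f y" "\<And>x y. g (x - y) = g x - g y"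
    and "\<And>i. f (frag_of i) = g (frag_of i)"
  shows "f x = g x"
proof (rule frag_induction[where S = UNIV and P = "\<lambda>x. f x = g x"])
  show "f 0 = g 0"
    using assms(1)[of 0 0] assms(2)[of 0 0] by simp
qed (use assms in auto)

lemma frag_extend_fun_diff:
  "frag_extend (\<lambda>i. f i - g i) x = frag_extend f x - frag_extend g x"
  by (rule frag_linear_eqI) (simp_all add: frag_extend_diff)

lemma ch_mult_diff_left: "(a - b) \<otimes> c = a \<otimes> c - b \<otimes> c"
  by (simp add: ch_mult_def frag_extend_diff)

lemma ch_mult_diff_right: "c \<otimes> (a - b) = c \<otimes> a - c \<otimes> b"
  by (simp add: ch_mult_def frag_extend_diff frag_extend_fun_diff)

lemma ch_act_diff_left: "(a - b) \<bullet> g = a \<bullet> g - b \<bullet> g"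
  by (simp add: ch_act_def frag_extend_diff)

lemma ch_act_diff_right: "a \<bullet> (g - g') = a \<bullet> g - a \<bullet> g'"
  by (simp add: ch_act_def frag_extend_diff frag_extend_fun_diff)

lemma L_diff: "L (a - b) = L a - L b"
  by (simp add: L_def frag_extend_diff)

lemma ch_mult_basis: "h i \<otimes> h j = (\<Sum>k=0..min i j. h (i + j - 2 * k))"
  by (simp add: ch_mult_def)

lemma ch_act_basis: "h i \<bullet> ht j = (\<Sum>k=0..i. ht (j - int i + 2 * int k))"
  by (simp add: ch_act_def)

lemma ch_mult_commute: "a \<otimes> b = b \<otimes> a"
proof -
  have 1: "h i \<otimes> b = b \<otimes> h i" for i
    by (rule frag_linear_eqI[where f = "\<lambda>b. h i \<otimes> b" and g = "\<lambda>b. b \<otimes> h i"])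
      (simp_all add: ch_mult_diff_left ch_mult_diff_right ch_mult_basis min.commute add.commute)
  show ?thesis
    by (rule frag_linear_eqI[where f = "\<lambda>a. a \<otimes> b" and g = "\<lambda>a. b \<otimes> a"])
      (simp_all add: ch_mult_diff_left ch_mult_diff_right 1)
qed

lemma ch_act_0_right: "a \<bullet> 0 = 0"
  using ch_act_diff_right[of a 0 0] by simp

lemma ch_act_sum_right: "a \<bullet> (\<Sum>i\<in>I. g i) = (\<Sum>i\<in>I. a \<bullet> g i)"
proof (induction I rule: infinite_finite_induct)
  case (insert x I)
  have "a \<bullet> (u + v) = a \<bullet> u + a \<bullet> v" for u v
    using ch_act_diff_right[of a u "- v"] ch_act_diff_right[of a 0 v]
    by (simp add: ch_act_0_right)
  with insert show ?case by simp
qed (simp_all add: ch_act_0_right)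

lemma ch_act_0_left: "0 \<bullet> g = 0"
  using ch_act_diff_left[of 0 0 g] by simp

lemma ch_act_sum_left: "(\<Sum>i\<in>I. a i) \<bullet> g = (\<Sum>i\<in>I. a i \<bullet> g)"
proof (induction I rule: infinite_finite_induct)
  case (insert x I)
  have "(u + v) \<bullet> g = u \<bullet> g + v \<bullet> g" for u v
    using ch_act_diff_left[of u "- v" g] ch_act_diff_left[of 0 v g]
    by (simp add: ch_act_0_left)
  with insert show ?case by simp
qed (simp_all add: ch_act_0_left)

lemma L_sum: "L (\<Sum>i\<in>I. g i) = (\<Sum>i\<in>I. L (g i))"
proof (induction I rule: infinite_finite_induct)
  case (insert x I)
  then show ?case by (simp add: L_def frag_extend_add)
qed (simp_all add: L_def)

lemma sum_rectangle:
  fixes f :: "nat \<Rightarrow> 'a::ab_group_add"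
  assumes "i \<le> j"
  shows "(\<Sum>k=0..i. \<Sum>l=k..i + j - k. f l) = (\<Sum>a=0..i. \<Sum>b=0..j. f (a + b))"
  using assms
proof (induction i)
  case (Suc i)
  have "(\<Sum>l=k..Suc i + j - k. f l) = (\<Sum>l=k..i + j - k. f l) + f (Suc i + j - k)"
    if "k \<le> i" for k
  proof -
    have "Suc i + j - k = Suc (i + j - k)" "k \<le> Suc (i + j - k)"
      using that Suc.prems by auto
    then show ?thesis by simp
  qed
  then have "(\<Sum>k=0..i. \<Sum>l=k..Suc i + j - k. f l)
      = (\<Sum>k=0..i. \<Sum>l=k..i + j - k. f l) + (\<Sum>k=0..i. f (Suc i + j - k))"
    by (simp add: sum.distrib)
  moreover have "(\<Sum>k=0..i. f (Suc i + j - k)) = (\<Sum>l=Suc j..Suc i + j. f l)"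
    by (rule sum.reindex_bij_witness[where i = "\<lambda>l. Suc i + j - l" and j = "\<lambda>k. Suc i + j - k"])
      auto
  moreover have "(\<Sum>l=Suc i..Suc i + j. f l) = (\<Sum>l=Suc i..j. f l) + (\<Sum>l=Suc j..Suc i + j. f l)"
  proof -
    have "{Suc i..Suc i + j} = {Suc i..j} \<union> {Suc j..Suc i + j}"
      using Suc.prems by auto
    then show ?thesis
      by (simp only:) (rule sum.union_disjoint, auto)
  qed
  moreover have "(\<Sum>b=0..j. f (Suc i + b)) = (\<Sum>l=Suc i..Suc i + j. f l)"
    by (rule sum.reindex_bij_witness[where i = "\<lambda>l. l - Suc i" and j = "\<lambda>b. Suc i + b"]) auto
  moreover have "(\<Sum>k=0..i. \<Sum>l=k..i + j - k. f l) = (\<Sum>a=0..i. \<Sum>b=0..j. f (a + b))"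
    using Suc by simp
  moreover have "Suc i + j - Suc i = j" by simp
  ultimately show ?case
    by (simp only: sum.atLeast0_atMost_Suc ac_simps)
qed simp

lemma ch_act_assoc_basis:
  assumes "i \<le> j"
  shows "(h i \<otimes> h j) \<bullet> ht m = h i \<bullet> h j \<bullet> ht m"
proof -
  define f where "f l = ht (m - int i - int j + 2 * int l)" for l
  have "(h i \<otimes> h j) \<bullet> ht m
      = (\<Sum>k=0..i. \<Sum>l=0..i + j - 2 * k. ht (m - int (i + j - 2 * k) + 2 * int l))"
    using assms by (simp add: ch_mult_basis ch_act_sum_left ch_act_basis min_absorb1)
  also have "\<dots> = (\<Sum>k=0..i. \<Sum>l=k..i + j - k. f l)"
  proof (rule sum.cong[OF refl])
    fix k assume "k \<in> {0..i}"
    then show "(\<Sum>l=0..i + j - 2 * k. ht (m - int (i + j - 2 * k) + 2 * int l))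
        = (\<Sum>l=k..i + j - k. f l)"
      using assms
      by (intro sum.reindex_bij_witness[where i = "\<lambda>l. l - k" and j = "\<lambda>l. l + k"])
        (auto simp: f_def of_nat_diff algebra_simps)
  qed
  also have "\<dots> = (\<Sum>a=0..i. \<Sum>b=0..j. f (a + b))"
    by (rule sum_rectangle[OF assms])
  also have "\<dots> = (\<Sum>b=0..j. \<Sum>a=0..i. f (a + b))"
    by (rule sum.swap)
  also have "\<dots> = h i \<bullet> h j \<bullet> ht m"
    by (simp add: ch_act_basis ch_act_sum_right f_def algebra_simps)
  finally show ?thesis .
qed

lemma ch_act_commute_basis: "h i \<bullet> h j \<bullet> ht m = h j \<bullet> h i \<bullet> ht m"
  by (simp only: ch_act_basis ch_act_sum_right, subst sum.swap) (simp add: algebra_simps)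

lemma ch_act_assoc: "(a \<otimes> b) \<bullet> g = a \<bullet> b \<bullet> g"
proof -
  have 1: "(h i \<otimes> h j) \<bullet> ht m = h i \<bullet> h j \<bullet> ht m" for i j m
    using ch_act_assoc_basis[of i j m] ch_act_assoc_basis[of j i m]
      ch_mult_commute[of "h i" "h j"] ch_act_commute_basis[of i j m]
    by (cases "i \<le> j") auto
  have 2: "(h i \<otimes> h j) \<bullet> g = h i \<bullet> h j \<bullet> g" for i j
    by (rule frag_linear_eqI[where f = "\<lambda>g. (h i \<otimes> h j) \<bullet> g" and g = "\<lambda>g. h i \<bullet> h j \<bullet> g"])
      (simp_all add: ch_act_diff_right 1)
  have 3: "(h i \<otimes> b) \<bullet> g = h i \<bullet> b \<bullet> g" for i
    by (rule frag_linear_eqI[where f = "\<lambda>b. (h i \<otimes> b) \<bullet> g" and g = "\<lambda>b. h i \<bullet> b \<bullet> g"])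
      (simp_all add: ch_act_diff_right ch_act_diff_left ch_mult_diff_right 2)
  show ?thesis
    by (rule frag_linear_eqI[where f = "\<lambda>a. (a \<otimes> b) \<bullet> g" and g = "\<lambda>a. a \<bullet> b \<bullet> g"])
      (simp_all add: ch_act_diff_left ch_mult_diff_left 3)
qed

lemma L_basis: "L (ht (int i)) = h i"
  by (simp add: L_def)

lemma L_reflect: "L (ht (- 2 - i)) = - L (ht i)"
  by (auto simp: L_def intro!: arg_cong[where f = h])

lemma eq_uminus_imp_0: "x = - x \<Longrightarrow> x = 0" for x :: ch
proof (rule poly_mapping_eqI)
  fix k assume "x = - x"
  then have "Poly_Mapping.lookup x k = - Poly_Mapping.lookup x k" by (metis lookup_uminus)
  then show "Poly_Mapping.lookup x k = Poly_Mapping.lookup 0 k" by simp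
qed

lemma L_sum_symmetric:
  assumes "m = - int d"
  shows "(\<Sum>k<d. L (ht (m + 2 * int k))) = 0" (is "?s = 0")
proof (rule eq_uminus_imp_0)
  have "?s = (\<Sum>k<d. L (ht (m + 2 * int (d - Suc k))))"
    by (rule sum.nat_diff_reindex[symmetric])
  also have "\<dots> = (\<Sum>k<d. - L (ht (m + 2 * int k)))"
  proof (rule sum.cong[OF refl])
    fix k assume "k \<in> {..<d}"
    then have "m + 2 * int (d - Suc k) = - 2 - (m + 2 * int k)"
      using assms by (auto simp: of_nat_diff)
    then show "L (ht (m + 2 * int (d - Suc k))) = - L (ht (m + 2 * int k))"
      by (simp only: L_reflect)
  qed
  finally show "?s = - ?s" by (simp add: sum_negf)
qed

lemma L_act_basis_nonneg: "L (h i \<bullet> ht (int j)) = h i \<otimes> h j"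
proof -
  have "L (h i \<bullet> ht (int j)) = (\<Sum>k<Suc i. L (ht (int j - int i + 2 * int k)))"
    by (simp add: ch_act_basis L_sum atLeast0AtMost lessThan_Suc_atMost)
  also have "{..<Suc i} = {..<i - j} \<union> {i - j..i}" by auto
  also have "(\<Sum>k\<in>\<dots>. L (ht (int j - int i + 2 * int k)))
      = (\<Sum>k<i - j. L (ht (int j - int i + 2 * int k)))
        + (\<Sum>k=i - j..i. L (ht (int j - int i + 2 * int k)))"
    by (rule sum.union_disjoint) auto
  also have "(\<Sum>k<i - j. L (ht (int j - int i + 2 * int k))) = 0"
    by (cases "j \<le> i") (auto intro!: L_sum_symmetric simp: of_nat_diff)
  also have "(\<Sum>k=i - j..i. L (ht (int j - int i + 2 * int k)))
      = (\<Sum>k=0..min i j. h (i + j - 2 * k))"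
  proof (rule sum.reindex_bij_witness[where i = "\<lambda>k. i - k" and j = "\<lambda>k. i - k"])
    fix k assume k: "k \<in> {i - j..i}"
    then have "int j - int i + 2 * int k = int (i + j - 2 * (i - k))"
      by (auto simp: of_nat_diff)
    then show "h (i + j - 2 * (i - k)) = L (ht (int j - int i + 2 * int k))"
      by (simp only: L_basis)
  qed auto
  finally show ?thesis by (simp add: ch_mult_basis)
qed

lemma L_act_basis_reflect: "L (h i \<bullet> ht (- 2 - j)) = - L (h i \<bullet> ht j)"
proof -
  have "L (h i \<bullet> ht (- 2 - j)) = (\<Sum>k=0..i. L (ht (- 2 - (j - int i + 2 * int (i - k)))))"
    by (auto simp: ch_act_basis L_sum of_nat_diff algebra_simps intro!: sum.cong)
  also have "\<dots> = (\<Sum>k=0..i. - L (ht (j - int i + 2 * int (i - k))))"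
    by (simp only: L_reflect)
  also have "\<dots> = (\<Sum>k=0..i. - L (ht (j - int i + 2 * int k)))"
    by (rule sum.reindex_bij_witness[where i = "\<lambda>k. i - k" and j = "\<lambda>k. i - k"]) auto
  finally show ?thesis by (simp add: ch_act_basis L_sum sum_negf)
qed

lemma L_act: "L (a \<bullet> g) = a \<otimes> L g"
proof -
  have minus: "a \<otimes> (- b) = - (a \<otimes> b)" for a b
    using ch_mult_diff_right[of a b b] ch_mult_diff_right[of a 0 b] by simp
  have 1: "L (h i \<bullet> ht j) = h i \<otimes> L (ht j)" for i j
  proof -
    consider (pos) m where "j = int m" | (mid) "j = -1" | (neg) m where "j = - 2 - int m"
    proof (cases "j \<ge> 0")
      case True then show ?thesis using pos[of "nat j"] by simp
    next
      case False then show ?thesis using mid neg[of "nat (- 2 - j)"] by (cases "j = -1") auto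
    qed
    then show ?thesis
    proof cases
      case pos then show ?thesis by (simp only: L_act_basis_nonneg L_basis)
    next
      case mid
      have "L (h i \<bullet> ht (-1)) = 0"
        using L_act_basis_reflect[of i "-1"] by (intro eq_uminus_imp_0) simp
      moreover have "L (ht (-1)) = 0" by (simp add: L_def)
      moreover have "h i \<otimes> 0 = 0" using ch_mult_diff_right[of "h i" 0 0] by simp
      ultimately show ?thesis using mid by simp
    next
      case neg
      then show ?thesis
        by (simp only: L_act_basis_reflect L_act_basis_nonneg L_reflect L_basis minus)
    qed
  qed
  have 2: "L (h i \<bullet> g) = h i \<otimes> L g" for i
    by (rule frag_linear_eqI[where f = "\<lambda>g. L (h i \<bullet> g)" and g = "\<lambda>g. h i \<otimes> L g"])
      (simp_all add: ch_act_diff_right ch_mult_diff_right L_diff 1)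
  show ?thesis
    by (rule frag_linear_eqI[where f = "\<lambda>a. L (a \<bullet> g)" and g = "\<lambda>a. a \<otimes> L g"])
      (simp_all add: ch_act_diff_left ch_mult_diff_left L_diff 2)
qed

lemma ch_mult_assoc: "(a \<otimes> b) \<otimes> c = a \<otimes> (b \<otimes> c)"
proof -
  have "L (frag_extend (\<lambda>i. ht (int i)) c) = c"
    by (rule frag_linear_eqI[where f = "\<lambda>c. L (frag_extend (\<lambda>i. ht (int i)) c)" and g = "\<lambda>c. c"])
      (simp_all add: frag_extend_diff L_diff L_basis)
  then show ?thesis
    by (metis L_act ch_act_assoc)
qed

lemma ch_mult_1: "h 0 \<otimes> a = a"
  by (rule frag_linear_eqI[where f = "\<lambda>a. h 0 \<otimes> a" and g = "\<lambda>a. a"])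
    (simp_all add: ch_mult_diff_right ch_mult_basis del: single_one)

lemma ch_act_1: "h 0 \<bullet> g = g"
  by (rule frag_linear_eqI[where f = "\<lambda>g. h 0 \<bullet> g" and g = "\<lambda>g. g"])
    (simp_all add: ch_act_diff_right ch_act_basis del: single_one)

lemma cht_mult_assoc: "(f \<odot> g) \<odot> k = f \<odot> (g \<odot> k)"
  by (simp add: cht_mult_def L_act ch_act_assoc)

end

theory Submission
  imports Defs
begin

text \<open>
  Read \<open>ht i\<close> as the monomial \<open>x\<^sup>i\<close>. The action of \<open>h i\<close> is then multiplication by the
  symmetric Laurent polynomial \<open>x\<^sup>-\<^sup>i + x\<^sup>2\<^sup>-\<^sup>i + \<dots> + x\<^sup>i\<close> and \<open>S i\<close> is multiplication by
  \<open>x\<^sup>i\<close>, so everything takes place in a commutative ring, whose product is the convolution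
  \<open>*\<close> of the library. Let \<open>N g\<close> be the symmetric
  polynomial by which \<open>L g\<close> acts and \<open>t = 1/x\<close>. Then \<open>g = N g - t * N (t * g)\<close>, which collapses the
  two ternary operations to \<open>W0 f g k = N g * f * k\<close> and \<open>W1 f g k = t * N g * f * k\<close>. The first identity
  follows at once, and the induction step of the second becomes a polynomial identity.
\<close>

definition N :: "cht \<Rightarrow> cht" where
  "N g = L g \<bullet> ht 0"

lemma ht_mult: "ht i * ht j = ht (i + j)"
  by (simp add: mult_single)

lemma S_eq_mult: "S i g = ht i * g"
  by (rule frag_linear_eqI[where f = "S i" and g = "\<lambda>g. ht i * g"])
    (simp_all add: S_def frag_extend_diff right_diff_distrib ht_mult add.commute)

lemma ch_act_eq_mult: "a \<bullet> g = (a \<bullet> ht 0) * g"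
proof -
  have basis: "h i \<bullet> ht j = (h i \<bullet> ht 0) * ht j" for i j
    by (simp add: ch_act_basis sum_distrib_right ht_mult diff_add_eq add_diff_eq add.commute del: single_one)
  have act: "h i \<bullet> g = (h i \<bullet> ht 0) * g" for i
    by (rule frag_linear_eqI[where f = "\<lambda>g. h i \<bullet> g" and g = "\<lambda>g. (h i \<bullet> ht 0) * g"])
      (simp_all only: ch_act_diff_right right_diff_distrib basis[symmetric])
  show ?thesis
    by (rule frag_linear_eqI[where f = "\<lambda>a. a \<bullet> g" and g = "\<lambda>a. (a \<bullet> ht 0) * g"])
      (simp_all only: ch_act_diff_left left_diff_distrib act[symmetric])
qed

lemma cht_mult_eq_mult: "f \<odot> g = N f * g"
  unfolding cht_mult_def N_def by (rule ch_act_eq_mult)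

lemma N_diff: "N (f - g) = N f - N g"
  by (simp add: N_def L_diff ch_act_diff_left)

lemma N_0: "N 0 = 0"
  using N_diff[of 0 0] by simp

lemma N_add: "N (f + g) = N f + N g"
  using N_diff[of f "- g"] N_diff[of 0 g] by (simp add: N_0)

text \<open>Equivariance of \<open>L\<close> makes \<open>N\<close> linear over its own
  image.\<close>

lemma N_mult_N: "N (N f * g) = N f * N g"
  unfolding cht_mult_eq_mult[symmetric]
  by (simp add: N_def cht_mult_def L_act ch_act_assoc)

lemma N_ht_1: "N (ht 1) = ht 1 + ht (-1)"
proof -
  have "N (ht 1) = h 1 \<bullet> ht 0"
    using L_basis[of 1] by (simp add: N_def del: single_one)
  also have "\<dots> = ht 1 + ht (-1)"
    unfolding ch_act_basis by (simp add: add.commute)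
  finally show ?thesis .
qed

lemma N_ht_1_mult: "N ((ht 1 + ht (-1)) * g) = (ht 1 + ht (-1)) * N g"
  using N_mult_N[of "ht 1" g] by (simp add: N_ht_1)

text \<open>The factor \<open>ht 1 + ht (-1)\<close> is \<open>N (ht 1)\<close>, so it can be pulled
  out of \<open>N\<close>.\<close>

lemma N_shift2: "N (ht (-2) * g) = (ht 1 + ht (-1)) * N (ht (-1) * g) - N g"
proof -
  have "(ht 1 + ht (-1)) * (ht (-1) * g) = g + ht (-2) * g"
    by (simp add: distrib_right ht_mult mult.assoc[symmetric])
  then show ?thesis
    using N_ht_1_mult[of "ht (-1) * g"] by (simp add: N_add eq_diff_eq add.commute)
qed

text \<open>The defect \<open>D\<close> commutes with multiplication by
  \<open>ht 1 + ht (-1)\<close>, so \<open>D (ht i)\<close> obeys a three-term recurrence solvable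
  in both directions; it vanishes at \<open>i = 0\<close> and \<open>i = -1\<close>, hence
  everywhere.\<close>

lemma N_decomposition: "g = N g - ht (-1) * N (ht (-1) * g)"
proof -
  define D where "D g = g - N g + ht (-1) * N (ht (-1) * g)" for g
  have D_diff: "D (f - g) = D f - D g" for f g
    by (simp add: D_def N_diff right_diff_distrib)
  have D_mult: "D ((ht 1 + ht (-1)) * g) = (ht 1 + ht (-1)) * D g" for g
    unfolding D_def mult.left_commute[of "ht (-1)" "ht 1 + ht (-1)"] N_ht_1_mult
    by (simp add: algebra_simps)
  have rec: "D (ht (i + 1)) + D (ht (i - 1)) = (ht 1 + ht (-1)) * D (ht i)" for i
    using D_mult[of "ht i"] D_diff[of "ht (i + 1)" "- ht (i - 1)"] D_diff[of 0 "ht (i - 1)"]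
      D_diff[of 0 0]
    by (simp add: distrib_right ht_mult add.commute)
  have N_ht_0: "N (ht 0) = ht 0"
    using L_basis[of 0] by (simp add: N_def ch_act_1 del: single_one)
  have N_ht_m1: "N (ht (-1)) = 0"
    by (simp add: N_def L_def ch_act_0_left)
  have "D (ht 0) = 0"
    using N_ht_0 N_ht_m1 by (simp add: D_def)
  moreover have "D (ht (-1)) = 0"
    using N_shift2[of "ht 0"] N_ht_0 N_ht_m1 by (simp add: D_def ht_mult)
  ultimately have D_ht: "D (ht i) = 0 \<and> D (ht (i - 1)) = 0" for i
  proof (induction i rule: int_induct[where k = 0])
    case (step1 i)
    then show ?case using rec[of i] by simp
  next
    case (step2 i)
    then show ?case using rec[of "i - 1"] by simp
  qed simp
  have "D g = 0"
    by (rule frag_linear_eqI[where f = D and g = "\<lambda>_. 0"]) (simp_all add: D_diff D_ht)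
  then show ?thesis
    by (simp add: D_def algebra_simps)
qed

lemma W0_eq_mult: "W0 f g k = N g * f * k"
proof -
  have "W0 f g k = N g * (N f - ht (-1) * N (ht (-1) * f)) * k"
    by (simp add: W0_def S_eq_mult cht_mult_eq_mult algebra_simps)
  then show ?thesis
    using N_decomposition[of f] by simp
qed

text \<open>The summands of \<open>W1\<close> regroup as \<open>N g * k\<close> times the
  decomposition of \<open>S (-1) f\<close>, with \<open>N (ht (-2) * f)\<close> expanded by
  \<open>N_shift2\<close>.\<close>

lemma W1_eq_shift_W0: "W1 f g k = S (-1) (W0 f g k)"
proof -
  have "S (-1) f = N (S (-1) f) - ht (-1) * N (ht (-2) * f)"
    using N_decomposition[of "S (-1) f"] by (simp add: S_eq_mult ht_mult mult.assoc[symmetric])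
  then have "N g * S (-1) f * k
      = N g * (N (S (-1) f) - ht (-1) * ((ht 1 + ht (-1)) * N (S (-1) f) - N f)) * k"
    by (simp add: N_shift2 S_eq_mult)
  then show ?thesis
    unfolding W1_def W0_eq_mult S_eq_mult cht_mult_assoc
    unfolding cht_mult_eq_mult N_ht_1
    by (simp only: algebra_simps)
qed

text \<open>No induction: both recursions use the same earlier values.\<close>

lemma et_1_1_eq: "et_1_1 n = S (-1) (et_0_1 n)"
  by (cases n) (simp_all add: W1_eq_shift_W0, simp_all add: S_eq_mult distrib_left)

text \<open>Here \<open>a, b, c, d, m\<close> stand for \<open>N E\<close>, \<open>N (t E)\<close>, \<open>N F\<close>, \<open>N (t F)\<close> and
  \<open>N (t F + t\<^sup>2 E)\<close>.\<close>

lemma step_identity: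
  fixes x t a b c d :: "'a::comm_ring_1"
  assumes "x * t = 1" and E: "E = a - t * b" and F: "F = c - t * d"
    and m: "m = d + (x + t) * b - a"
  shows "m * a * E + c * a * (t * E) - m * (x + t) * a * (t * E) + 2 * (b * a * (t * E))
      - b * (x + t) * b * (t * E) + b * ((x + t) * b - a) * (t * E)
    = t * (a * F * E) + t * (t * (a * E * E))" (is "?lhs = _")
proof -
  have yt: "(x + t) * t = 1 + t * t"
    using assms(1) by (simp add: distrib_right)
  have "?lhs = a * E * (m - m * ((x + t) * t) + c * t + b * t)"
    by (simp add: algebra_simps)
  also have "m - m * ((x + t) * t) = - (m * t * t)"
    unfolding yt by (simp add: algebra_simps)
  also have "m * t * t = d * t * t + b * ((x + t) * t) * t - a * t * t"
    by (simp add: m algebra_simps)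
  also have "a * E * (- \<dots> + c * t + b * t) = a * E * (t * F + t * (t * E))"
    unfolding yt by (simp add: E F algebra_simps)
  finally show ?thesis
    by (simp add: algebra_simps)
qed

lemma et_m1_1_eq: "et_m1_1 n = S (-1) (et_0_1 n) + S (-2) (et_0_0 n)"
proof (induction n)
  case 0
  then show ?case by (simp add: S_def)
next
  case (Suc n)
  define E F where "E = et_0_0 n" and "F = et_0_1 n"
  define M where "M = et_m1_1 n"
  define x t :: cht where "x = ht 1" and "t = ht (-1)"
  have xt: "x * t = 1" and tt: "ht (-2) = t * t"
    by (simp_all add: x_def t_def ht_mult)
  have M: "M = t * F + t * t * E"
    using Suc by (simp add: M_def E_def F_def S_eq_mult t_def ht_mult)
  have diff: "M - et_1_1 n = t * t * E"
    by (simp add: M et_1_1_eq S_eq_mult F_def t_def)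
  have Ntt: "N (t * t * E) = (x + t) * N (t * E) - N E"
    using N_shift2[of E] by (simp only: tt x_def[symmetric] t_def[symmetric])
  have NM: "N M = N (t * F) + (x + t) * N (t * E) - N E"
    by (simp add: M N_add Ntt)
  have Nx: "N x = x + t"
    by (simp add: x_def t_def N_ht_1)
  have E: "E = N E - t * N (t * E)" and F: "F = N F - t * N (t * F)"
    unfolding t_def by (rule N_decomposition)+
  have cmul2: "frag_cmul 2 g = 2 * g" for g :: cht
    using frag_cmul_distrib[of 1 1 g] by (simp only: one_add_one frag_cmul_one mult_2)
  have E0: "et_0_0 (Suc n) = N E * E * E"
    using W0_eq_mult[of E E E] by (simp add: E_def W0_def)
  \<comment> \<open>The bracket collects all but the two \<open>W1\<close> summands; it is the left
    side of \<open>step_identity\<close> with \<open>m = N M\<close>.\<close>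
  have "et_m1_1 (Suc n) = t * W0 E E (F + t * E) + t * W0 E F E
    + (N M * N E * E + N F * N E * (t * E) - N M * (x + t) * N E * (t * E)
      + 2 * (N (t * E) * N E * (t * E))
      - N (t * E) * (x + t) * N (t * E) * (t * E)
      + N (t * E) * ((x + t) * N (t * E) - N E) * (t * E))"
    unfolding et_m1_1.simps cht_mult_assoc E_def[symmetric] F_def[symmetric] M_def[symmetric]
      x_def[symmetric] diff W1_eq_shift_W0 S_eq_mult t_def[symmetric] cmul2
    unfolding cht_mult_eq_mult Nx Ntt
    by (simp only: algebra_simps)
  also have "\<dots> = t * W0 E E (F + t * E) + t * W0 E F E
      + (t * (N E * F * E) + t * (t * (N E * E * E)))"
    by (simp only: step_identity[OF xt E F NM])
  \<comment> \<open>Here \<open>t * (N E * F * E)\<close> supplies the third summand, the shift of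
    \<open>W0 F E E\<close>.\<close>
  also have "\<dots> = S (-1) (et_0_1 (Suc n)) + S (-2) (et_0_0 (Suc n))"
    unfolding E0 by (simp add: E_def[symmetric] F_def[symmetric] S_eq_mult t_def[symmetric]
        tt W0_eq_mult algebra_simps)
  finally show ?case .
qed

theorem theorem3:
  fixes n :: nat
  shows "et_1_1 n = S (-1) (et_0_1 n) \<and>
    et_m1_1 n = S (-1) (et_0_1 n) + S (-2) (et_0_0 n)"
  by (simp add: et_1_1_eq et_m1_1_eq)

end
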